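(* There are totally bounded, nonmetrizable, determined groups.
   Context: All groups are Abelian, and the groups in question are topological groups. $\mathbb T$ is the circle group, $(-\tfrac12,\tfrac12]$ with addition mod $1$ and its usual compact metrizable topology. For a topological Abelian group $G$, $\widehat G$ is the group of continuous homomorphisms $G\to\mathbb T$ with the compact-open topology. A dense subgroup $D$ of $G$ determines $G$ if the restriction map $\widehat G\to\widehat D$, $h\mapsto h|D$ (which is always a continuous group isomorphism) is a homeomorphism. $G$ is determined if every dense subgroup of $G$ determines $G$. $G$ is totally bounded if for every nonempty open $V\subseteq G$ there is a finite $F\subseteq G$ with $G=F+V$. *)

theory Defs
  imports "HOL-Analysis.Analysis" "HOL-Algebra.Coset"
begin

(* Groups are HOL-Algebra groups with an explicit carrier, and the topology is a separate
   abstract topology whose underlying set is that carrier.  Being Hausdorff is not part of the locale. *)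

locale topological_abelian_group = comm_group G for G (structure) +
  fixes T :: "'a topology"
  assumes topspace_eq: "topspace T = carrier G"
    and continuous_mult: "continuous_map (prod_topology T T) T (\<lambda>(x, y). x \<otimes> y)"
    and continuous_inv: "continuous_map T T (\<lambda>x. inv x)"

(* the representative of t modulo 1 in the half-open interval (-1/2, 1/2] *)
definition circle_rep :: "real \<Rightarrow> real" where
  "circle_rep t = t - of_int \<lceil>t - 1/2\<rceil>"

definition circle_group :: "real monoid" where
  "circle_group = \<lparr>carrier = {-1/2<..1/2}, mult = (\<lambda>x y. circle_rep (x + y)), one = 0\<rparr>"

(* The topology making t \<mapsto> exp (2 pi i t) a homeomorphism onto the unit circle; it is not the
   subspace topology of the interval, since points near -1/2 are close to 1/2. *)
definition circle_topology :: "real topology" where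
  "circle_topology = pullback_topology (carrier circle_group) (\<lambda>t. cis (2 * pi * t)) euclidean"

(* Homomorphisms are made undefined off the carrier of G, so that they are determined by their
   values on G. *)
definition dual_group :: "('a, 'b) monoid_scheme \<Rightarrow> 'a topology \<Rightarrow> ('a \<Rightarrow> real) monoid" where
  "dual_group G T =
     \<lparr>carrier = {h \<in> hom G circle_group \<inter> extensional (carrier G). continuous_map T circle_topology h},
      mult = (\<lambda>h k. \<lambda>x\<in>carrier G. h x \<otimes>\<^bsub>circle_group\<^esub> k x),
      one = (\<lambda>x\<in>carrier G. \<one>\<^bsub>circle_group\<^esub>)\<rparr>"

definition compact_open_topology :: "('a, 'b) monoid_scheme \<Rightarrow> 'a topology \<Rightarrow> ('a \<Rightarrow> real) topology" where
  "compact_open_topology G T =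
     topology_generated_by
       {{h \<in> carrier (dual_group G T). h ` K \<subseteq> U} | K U. compactin T K \<and> openin circle_topology U}"

definition dense_subgroup :: "'a set \<Rightarrow> ('a, 'b) monoid_scheme \<Rightarrow> 'a topology \<Rightarrow> bool" where
  "dense_subgroup D G T \<longleftrightarrow> subgroup D G \<and> T closure_of D = topspace T"

definition determines :: "'a set \<Rightarrow> ('a, 'b) monoid_scheme \<Rightarrow> 'a topology \<Rightarrow> bool" where
  "determines D G T \<longleftrightarrow>
     homeomorphic_map (compact_open_topology G T)
       (compact_open_topology (G\<lparr>carrier := D\<rparr>) (subtopology T D)) (\<lambda>h. restrict h D)"

definition determined :: "('a, 'b) monoid_scheme \<Rightarrow> 'a topology \<Rightarrow> bool" where
  "determined G T \<longleftrightarrow> (\<forall>D. dense_subgroup D G T \<longrightarrow> determines D G T)"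

definition totally_bounded_group :: "('a, 'b) monoid_scheme \<Rightarrow> 'a topology \<Rightarrow> bool" where
  "totally_bounded_group G T \<longleftrightarrow>
     (\<forall>V. openin T V \<and> V \<noteq> {} \<longrightarrow>
        (\<exists>F. finite F \<and> F \<subseteq> carrier G \<and> carrier G = F <#>\<^bsub>G\<^esub> V))"

lemma topspace_compact_open_topology:
  "topspace (compact_open_topology G T) = carrier (dual_group G T)"
proof -
  have "carrier (dual_group G T) \<in>
      {{h \<in> carrier (dual_group G T). h ` K \<subseteq> U} | K U. compactin T K \<and> openin circle_topology U}"
    by (rule CollectI, rule exI[of _ "{}"], rule exI[of _ "{}"]) auto
  then show ?thesis
    unfolding compact_open_topology_def topology_generated_by_topspace by blast
qed

lemma circle_rep_mem: "circle_rep t \<in> {-1/2<..1/2}"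
  proof -
  have "of_int \<lceil>t - 1/2\<rceil> - 1 < t - 1/2" "t - 1/2 \<le> of_int \<lceil>t - 1/2\<rceil>"
    using ceiling_correct[of "t - 1/2"] by blast+
  then show ?thesis unfolding circle_rep_def greaterThanAtMost_iff by linarith
qed

lemma circle_rep_ident: "t \<in> {-1/2<..1/2} \<Longrightarrow> circle_rep t = t"
proof -
  assume "t \<in> {-1/2<..1/2}"
  then have "\<lceil>t - 1/2\<rceil> = 0" by (simp add: ceiling_eq_iff)
  then show ?thesis by (simp add: circle_rep_def)
qed

lemma circle_rep_add_of_int: "circle_rep (t + of_int n) = circle_rep t"
proof -
  have "t + of_int n - 1/2 = (t - 1/2) + of_int n" by simp
  then have "\<lceil>t + of_int n - 1/2\<rceil> = \<lceil>t - 1/2\<rceil> + n" by (metis ceiling_add_of_int)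
  then show ?thesis by (simp add: circle_rep_def)
qed

lemma circle_rep_add_left: "circle_rep (circle_rep x + y) = circle_rep (x + y)"
  using circle_rep_add_of_int[of "x + y" "- \<lceil>x - 1/2\<rceil>"]
  by (simp add: circle_rep_def algebra_simps)

lemma circle_rep_add_right: "circle_rep (x + circle_rep y) = circle_rep (x + y)"
  using circle_rep_add_left[of y x] by (simp add: add.commute)

lemma comm_group_circle: "comm_group circle_group"
proof (rule comm_groupI)
  fix x assume "x \<in> carrier circle_group"
  show "\<exists>y\<in>carrier circle_group. y \<otimes>\<^bsub>circle_group\<^esub> x = \<one>\<^bsub>circle_group\<^esub>"
    by (rule bexI[of _ "circle_rep (- x)"])
      (use circle_rep_mem[of "- x"] circle_rep_ident[of 0] in
        \<open>simp_all add: circle_group_def circle_rep_add_left\<close>)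
qed (use circle_rep_mem in \<open>auto simp: circle_group_def circle_rep_add_left circle_rep_add_right
       circle_rep_ident add.commute add.left_commute add.assoc\<close>)

lemma topspace_circle: "topspace circle_topology = carrier circle_group"
  by (simp add: circle_topology_def topspace_pullback_topology)

end

theory Submission
  imports Defs
begin

text \<open>
  If every subgroup of a topological group is closed, then the only dense subgroup is the whole group,
  and the group is determined for a trivial reason: the restriction map to a dense subgroup is the
  identity. It therefore suffices to find a totally bounded, nonmetrizable Hausdorff group without
  non-closed subgroups. Any infinite Abelian group with its Bohr topology, the coarsest one making all
  homomorphisms to the circle continuous, has these properties.

  The group chosen here makes the arguments elementary: the finite subsets of an infinite set under
  symmetric difference, a vector space over the field with two elements. Its homomorphisms to
  \<open>{0, 1}\<close> send \<open>X\<close> to the parity of \<open>A \<inter> X\<close>, one for each subset \<open>A\<close>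
  of the infinite set, and the topology is the coarsest one making all of them continuous.

  \<^item> Total boundedness: a basic open set prescribes finitely many parities, and these split the group
  into finitely many classes.

  \<^item> Closed subgroups (\<open>parity_separates_subgroup\<close>): a point outside a subgroup is separated from it
  by a parity, because a subgroup that is maximal among those avoiding the point has index two.

  \<^item> Nonmetrizability (\<open>not_first_countable_parity_topology\<close>): finitely many translates of an open set
  \<open>V\<close> cover the group, so a parity vanishing on \<open>V\<close> is known once its values at finitely many points
  are known. Only finitely many parities vanish on \<open>V\<close>. Every parity vanishes on some member of
  a base at the identity, so a countable base would leave only countably many parities, but there are
  uncountably many sets \<open>A\<close>.
\<close>

section \<open>The group of finite sets and its parity characters\<close>

definition finite_set_group :: "'a set monoid" where
  "finite_set_group = \<lparr>carrier = Collect finite, mult = sym_diff, one = {}\<rparr>"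

lemma finite_set_group_simps [simp]:
  "carrier finite_set_group = Collect finite"
  "X \<otimes>\<^bsub>finite_set_group\<^esub> Y = sym_diff X Y"
  "\<one>\<^bsub>finite_set_group\<^esub> = {}"
  by (simp_all add: finite_set_group_def)

lemma comm_group_finite_set_group: "comm_group finite_set_group"
proof (rule comm_groupI)
  fix X :: "'a set"
  assume "X \<in> carrier finite_set_group"
  then show "\<exists>Y\<in>carrier finite_set_group. Y \<otimes>\<^bsub>finite_set_group\<^esub> X = \<one>\<^bsub>finite_set_group\<^esub>"
    by (auto intro!: bexI[of _ X])
qed auto

lemma inv_finite_set_group:
  assumes "finite X"
  shows "inv\<^bsub>finite_set_group\<^esub> X = X"
proof -
  interpret comm_group "finite_set_group :: 'a set monoid"
    by (rule comm_group_finite_set_group)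
  show ?thesis using assms by (intro inv_equality) auto
qed

text \<open>
  The truth values, with inequality as addition, serve as the group of order two: for fixed \<open>A\<close>
  this is the homomorphism that sends the singletons in \<open>A\<close> to \<open>True\<close> and all other singletons
  to \<open>False\<close>.
\<close>

definition parity :: "'a set \<Rightarrow> 'a set \<Rightarrow> bool" where
  "parity A X \<longleftrightarrow> odd (card (A \<inter> X))"

lemma parity_empty [simp]: "\<not> parity A {}"
  by (simp add: parity_def)

lemma parity_singleton [simp]: "parity A {x} \<longleftrightarrow> x \<in> A"
  by (auto simp: parity_def Int_insert_right)

lemma parity_of_singleton [simp]: "parity {n} X \<longleftrightarrow> n \<in> X"
  by (cases "n \<in> X") (simp_all add: parity_def)

lemma parity_sym_diff:
  assumes "finite X" "finite Y"
  shows "parity A (sym_diff X Y) \<longleftrightarrow> parity A X \<noteq> parity A Y"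
proof -
  let ?P = "A \<inter> X" and ?Q = "A \<inter> Y"
  have fin: "finite ?P" "finite ?Q" using assms by auto
  have "card ?P = card (?P - ?Q) + card (?P \<inter> ?Q)"
    using card_Int_Diff[OF fin(1), of ?Q] by simp
  moreover have "card ?Q = card (?Q - ?P) + card (?P \<inter> ?Q)"
    using card_Int_Diff[OF fin(2), of ?P] by (simp add: Int_commute)
  moreover have "card (A \<inter> sym_diff X Y) = card (?P - ?Q) + card (?Q - ?P)"
  proof -
    have "A \<inter> sym_diff X Y = (?P - ?Q) \<union> (?Q - ?P)" by auto
    then show ?thesis using fin by (simp add: card_Un_disjoint Diff_disjoint disjoint_iff)
  qed
  ultimately show ?thesis unfolding parity_def by presburger
qed

lemma subgroup_finite_set_groupD:
  assumes "subgroup M finite_set_group"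
  shows "{} \<in> M" "X \<in> M \<Longrightarrow> finite X" "X \<in> M \<Longrightarrow> Y \<in> M \<Longrightarrow> sym_diff X Y \<in> M"
  using subgroup.one_closed[OF assms] subgroup.subset[OF assms] subgroup.m_closed[OF assms]
  by auto

lemma subgroup_finite_set_groupI:
  assumes "\<And>X. X \<in> M \<Longrightarrow> finite X" "{} \<in> M"
    and "\<And>X Y. X \<in> M \<Longrightarrow> Y \<in> M \<Longrightarrow> sym_diff X Y \<in> M"
  shows "subgroup M finite_set_group"
  using assms by unfold_locales (auto simp: inv_finite_set_group)

text \<open>Zorn's lemma applies because the union of a chain of subgroups is a subgroup.\<close>

lemma exists_maximal_subgroup_avoiding:
  assumes D: "subgroup D finite_set_group" and x: "x \<notin> D"
  obtains M where "subgroup M finite_set_group" "D \<subseteq> M" "x \<notin> M"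
    "\<And>N. subgroup N finite_set_group \<Longrightarrow> M \<subseteq> N \<Longrightarrow> x \<notin> N \<Longrightarrow> N = M"
proof -
  let ?\<A> = "{M. subgroup M finite_set_group \<and> D \<subseteq> M \<and> x \<notin> M}"
  have "\<exists>M\<in>?\<A>. \<forall>N\<in>?\<A>. M \<subseteq> N \<longrightarrow> N = M"
  proof (rule subset_Zorn_nonempty)
    show "?\<A> \<noteq> {}" using assms by blast
  next
    fix \<C> assume ne: "\<C> \<noteq> {}" and "subset.chain ?\<A> \<C>"
    then have sub: "\<C> \<subseteq> ?\<A>" and lin: "\<And>M N. M \<in> \<C> \<Longrightarrow> N \<in> \<C> \<Longrightarrow> M \<subseteq> N \<or> N \<subseteq> M"
      by (auto simp: subset_chain_def)
    have "subgroup (\<Union>\<C>) finite_set_group"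
    proof (rule subgroup_finite_set_groupI)
      show "finite X" if "X \<in> \<Union>\<C>" for X
        using that sub subgroup_finite_set_groupD(2) by blast
      show "{} \<in> \<Union>\<C>"
        using ne sub subgroup_finite_set_groupD(1) by blast
      fix X Y assume "X \<in> \<Union>\<C>" "Y \<in> \<Union>\<C>"
      then obtain M where "M \<in> \<C>" "X \<in> M" "Y \<in> M" using lin by blast
      then show "sym_diff X Y \<in> \<Union>\<C>"
        using sub subgroup_finite_set_groupD(3)[of M X Y] by blast
    qed
    then show "\<Union>\<C> \<in> ?\<A>" using ne sub by blast
  qed
  then obtain M where M: "M \<in> ?\<A>" and maxM: "\<forall>N\<in>?\<A>. M \<subseteq> N \<longrightarrow> N = M" ..
  show thesis
  proof (rule that)
    show "subgroup M finite_set_group" "D \<subseteq> M" "x \<notin> M" using M by simp_all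
    show "N = M" if "subgroup N finite_set_group" "M \<subseteq> N" "x \<notin> N" for N
    proof -
      have "N \<in> ?\<A>" using that(1,3) subset_trans[OF _ that(2)] M by simp
      with maxM have "M \<subseteq> N \<longrightarrow> N = M" by (rule bspec)
      then show "N = M" using that(2) by (rule mp)
    qed
  qed
qed

text \<open>
  By maximality the subgroup generated by \<open>M\<close> and \<open>y\<close>, which is \<open>M\<close> together with the coset of
  \<open>y\<close>, contains \<open>x\<close>. Hence \<open>y\<close> lies in the coset of \<open>x\<close>, so that this coset
  is the only nontrivial one.
\<close>

lemma maximal_subgroup_avoiding_index_two:
  assumes M: "subgroup M finite_set_group" and x: "finite x" "x \<notin> M"
    and max: "\<And>N. subgroup N finite_set_group \<Longrightarrow> M \<subseteq> N \<Longrightarrow> x \<notin> N \<Longrightarrow> N = M"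
    and y: "finite y" "y \<notin> M"
  shows "sym_diff x y \<in> M"
proof -
  note MD = subgroup_finite_set_groupD[OF M]
  let ?N = "M \<union> sym_diff y ` M"
  have "subgroup ?N finite_set_group"
  proof (rule subgroup_finite_set_groupI)
    show "finite X" if "X \<in> ?N" for X using that MD y by auto
    show "{} \<in> ?N" using MD by simp
    fix X Y assume XY: "X \<in> ?N" "Y \<in> ?N"
    have *: "X \<in> ?N \<longleftrightarrow> X \<in> M \<or> sym_diff y X \<in> M" for X
    proof -
      have "X = sym_diff y (sym_diff y X)" by blast
      moreover have "sym_diff y (sym_diff y Z) = Z" for Z by blast
      ultimately show ?thesis by (auto simp: image_iff)
    qed
    have eqs: "sym_diff (sym_diff y X) Y = sym_diff y (sym_diff X Y)"
      "sym_diff X (sym_diff y Y) = sym_diff y (sym_diff X Y)"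
      "sym_diff (sym_diff y X) (sym_diff y Y) = sym_diff X Y" by blast+
    from XY consider "X \<in> M" "Y \<in> M" | "X \<in> M" "sym_diff y Y \<in> M"
      | "sym_diff y X \<in> M" "Y \<in> M" | "sym_diff y X \<in> M" "sym_diff y Y \<in> M"
      unfolding * by argo
    then have "sym_diff X Y \<in> M \<or> sym_diff y (sym_diff X Y) \<in> M"
    proof cases
      case 1
      then show ?thesis by (intro disjI1 MD(3))
    next
      case 2
      from MD(3)[OF this] show ?thesis unfolding eqs by (rule disjI2)
    next
      case 3
      from MD(3)[OF this] show ?thesis unfolding eqs by (rule disjI2)
    next
      case 4
      from MD(3)[OF this] show ?thesis unfolding eqs by (rule disjI1)
    qed
    then show "sym_diff X Y \<in> ?N" unfolding * .
  qed
  moreover have "y \<in> ?N" using MD(1) by (auto simp: image_iff intro: bexI[of _ "{}"])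
  ultimately have "x \<in> ?N" using max[of ?N] y by blast
  then obtain m where m: "m \<in> M" "x = sym_diff y m" using x by blast
  then have "sym_diff x y = m" by blast
  with m show ?thesis by simp
qed

text \<open>
  Membership in a subgroup \<open>M\<close> of index two is a homomorphism to the group of order two. As the
  singletons generate the group, it is the parity character of the set of those \<open>n\<close> with
  \<open>{n} \<notin> M\<close>.
\<close>

lemma parity_separates_subgroup:
  assumes D: "subgroup D finite_set_group" and x: "finite x" "x \<notin> D"
  obtains A where "\<And>X. X \<in> D \<Longrightarrow> \<not> parity A X" "parity A x"
proof -
  obtain M where M: "subgroup M finite_set_group" "D \<subseteq> M" "x \<notin> M"
    and max: "\<And>N. subgroup N finite_set_group \<Longrightarrow> M \<subseteq> N \<Longrightarrow> x \<notin> N \<Longrightarrow> N = M"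
    using exists_maximal_subgroup_avoiding[OF D x(2)] by blast
  note MD = subgroup_finite_set_groupD[OF M(1)]
  have xor: "sym_diff Y Z \<in> M \<longleftrightarrow> (Y \<in> M \<longleftrightarrow> Z \<in> M)" if "finite Y" "finite Z" for Y Z
  proof -
    have eqs: "sym_diff Y (sym_diff Y Z) = Z" "sym_diff (sym_diff Y Z) Z = Y"
      "sym_diff (sym_diff x Y) (sym_diff x Z) = sym_diff Y Z" by blast+
    have "sym_diff Y Z \<in> M" if "Y \<notin> M" "Z \<notin> M"
    proof -
      have "sym_diff x Y \<in> M" "sym_diff x Z \<in> M"
        using maximal_subgroup_avoiding_index_two[OF M(1) x(1) M(3) max] that
          \<open>finite Y\<close> \<open>finite Z\<close> by blast+
      from MD(3)[OF this] show ?thesis unfolding eqs .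
    qed
    moreover have "Y \<in> M \<Longrightarrow> Z \<in> M \<Longrightarrow> sym_diff Y Z \<in> M" by (rule MD(3))
    moreover have "Y \<in> M \<Longrightarrow> sym_diff Y Z \<in> M \<Longrightarrow> Z \<in> M"
      using MD(3)[of Y "sym_diff Y Z"] unfolding eqs .
    moreover have "sym_diff Y Z \<in> M \<Longrightarrow> Z \<in> M \<Longrightarrow> Y \<in> M"
      using MD(3)[of "sym_diff Y Z" Z] unfolding eqs .
    ultimately show ?thesis by argo
  qed
  define A where "A = {n. {n} \<notin> M}"
  have char: "X \<in> M \<longleftrightarrow> \<not> parity A X" if "finite X" for X
    using that
  proof induction
    case empty
    then show ?case using MD(1) by simp
  next
    case (insert n X)
    then have "insert n X = sym_diff {n} X" by auto
    moreover have "sym_diff {n} X \<in> M \<longleftrightarrow> ({n} \<in> M \<longleftrightarrow> X \<in> M)"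
      using insert by (intro xor) auto
    moreover have "parity A (sym_diff {n} X) \<longleftrightarrow> parity A {n} \<noteq> parity A X"
      using insert by (intro parity_sym_diff) auto
    moreover have "parity A {n} \<longleftrightarrow> {n} \<notin> M" by (simp add: A_def)
    ultimately show ?case using insert.IH by metis
  qed
  show thesis
  proof (rule that)
    show "\<not> parity A X" if "X \<in> D" for X using that M(2) MD(2) char by blast
    show "parity A x" using char[OF x(1)] M(3) by blast
  qed
qed

section \<open>The topology induced by the parity characters\<close>

text \<open>
  The evaluation map at all parity characters embeds the group in a power of the discrete two-point
  space. The resulting subspace topology is the coarsest one for which these characters are continuous.
\<close>

definition parity_topology :: "'a set topology" where
  "parity_topology = pullback_topology (Collect finite) (\<lambda>X A. parity A X)
     (product_topology (\<lambda>_. discrete_topology UNIV) UNIV)"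

lemma topspace_parity_topology [simp]: "topspace parity_topology = Collect finite"
  by (simp add: parity_topology_def topspace_pullback_topology)

lemma continuous_map_parity:
  fixes A :: "'a set"
  shows "continuous_map parity_topology (discrete_topology UNIV) (parity A)"
proof -
  have "continuous_map (parity_topology :: 'a set topology) (product_topology (\<lambda>_. discrete_topology UNIV) UNIV)
      (id \<circ> (\<lambda>X A. parity A X))"
    unfolding parity_topology_def by (rule continuous_map_pullback) simp
  then have "continuous_map parity_topology (discrete_topology UNIV) (\<lambda>X :: 'a set. parity A X)"
    unfolding continuous_map_componentwise_UNIV by simp
  then show ?thesis .
qed

lemma continuous_map_into_parity_topology:
  assumes "\<And>x. x \<in> topspace S \<Longrightarrow> finite (f x)"
    and "\<And>A. continuous_map S (discrete_topology UNIV) (\<lambda>x. parity A (f x))"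
  shows "continuous_map S parity_topology f"
  unfolding parity_topology_def
proof (rule continuous_map_pullback')
  show "continuous_map S (product_topology (\<lambda>_. discrete_topology UNIV) UNIV) ((\<lambda>X A. parity A X) \<circ> f)"
    using assms(2) by (simp add: continuous_map_componentwise_UNIV)
qed (use assms(1) in auto)

lemma parity_topology_neighbourhood:
  assumes U: "openin parity_topology U" and x: "x \<in> U"
  obtains S where "finite S" "\<And>Y. finite Y \<Longrightarrow> (\<And>A. A \<in> S \<Longrightarrow> parity A Y = parity A x) \<Longrightarrow> Y \<in> U"
proof -
  obtain W where W: "openin (product_topology (\<lambda>_. discrete_topology UNIV) UNIV) W"
    and UW: "U = (\<lambda>X A. parity A X) -` W \<inter> Collect finite"
    using U unfolding parity_topology_def openin_pullback_topology by blast
  have "(\<lambda>A. parity A x) \<in> W" using x UW by auto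
  then obtain B where B: "finite {A. B A \<noteq> UNIV}" "(\<lambda>A. parity A x) \<in> Pi\<^sub>E UNIV B" "Pi\<^sub>E UNIV B \<subseteq> W"
    using W unfolding openin_product_topology_alt by (auto; blast)
  show thesis
  proof (rule that[OF B(1)])
    fix Y assume "finite Y" and eq: "\<And>A. A \<in> {A. B A \<noteq> UNIV} \<Longrightarrow> parity A Y = parity A x"
    have "parity A Y \<in> B A" for A
      using B(2) eq[of A] by (cases "B A = UNIV") (auto simp: PiE_iff)
    then show "Y \<in> U" using B(3) UW \<open>finite Y\<close> by (auto simp: PiE_iff)
  qed
qed

lemma topological_abelian_group_parity:
  "topological_abelian_group finite_set_group parity_topology"
proof -
  interpret comm_group "finite_set_group :: 'a set monoid"
    by (rule comm_group_finite_set_group)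
  let ?T = "parity_topology :: 'a set topology" and ?B = "discrete_topology (UNIV :: bool set)"
  show ?thesis
  proof unfold_locales
    show "continuous_map (prod_topology ?T ?T) ?T (\<lambda>(X, Y). X \<otimes>\<^bsub>finite_set_group\<^esub> Y)"
    proof (rule continuous_map_into_parity_topology)
      fix A :: "'a set"
      have "continuous_map (prod_topology ?T ?T) (prod_topology ?B ?B)
          (\<lambda>p. (parity A (fst p), parity A (snd p)))"
        by (intro continuous_map_pairedI continuous_map_compose[OF continuous_map_fst, unfolded o_def]
            continuous_map_compose[OF continuous_map_snd, unfolded o_def] continuous_map_parity)
      moreover have "continuous_map (prod_topology ?B ?B) ?B (\<lambda>(p, q). p \<noteq> q)"
        by (simp flip: prod_topology_discrete_topology)
      ultimately have "continuous_map (prod_topology ?T ?T) ?B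
          ((\<lambda>(p, q). p \<noteq> q) \<circ> (\<lambda>p. (parity A (fst p), parity A (snd p))))"
        by (rule continuous_map_compose)
      then show "continuous_map (prod_topology ?T ?T) ?B
          (\<lambda>p. parity A (case p of (X, Y) \<Rightarrow> X \<otimes>\<^bsub>finite_set_group\<^esub> Y))"
        by (rule continuous_map_eq) (auto simp: parity_sym_diff)
    qed auto
    have "continuous_map ?T ?T id" by simp
    then show "continuous_map ?T ?T (\<lambda>X. inv\<^bsub>finite_set_group\<^esub> X)"
      by (rule continuous_map_eq) (simp add: inv_finite_set_group)
  qed simp
qed

lemma Hausdorff_space_parity_topology: "Hausdorff_space (parity_topology :: 'a set topology)"
proof (rule Hausdorff_space_injective_preimage)
  let ?f = "\<lambda>(X :: 'a set) A. parity A X"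
  show "Hausdorff_space (product_topology (\<lambda>_ :: 'a set. discrete_topology (UNIV :: bool set)) UNIV)"
    by (simp add: Hausdorff_space_product_topology)
  show "continuous_map parity_topology (product_topology (\<lambda>_. discrete_topology UNIV) UNIV) ?f"
    by (simp add: continuous_map_componentwise_UNIV continuous_map_parity)
  show "inj_on ?f (topspace parity_topology)"
  proof (rule inj_onI)
    fix X Y :: "'a set" assume "?f X = ?f Y"
    then have "parity {n} X = parity {n} Y" for n by (rule fun_cong)
    then show "X = Y" by auto
  qed
qed

text \<open>
  An open set around \<open>x\<close> contains all finite sets with the same parities as \<open>x\<close> for the characters
  from some finite set \<open>S\<close>. If \<open>R\<close> contains one finite set for each pattern of parities on
  \<open>S\<close> that occurs, then the translates by the elements \<open>r - x\<close>, \<open>r \<in> R\<close>, cover the group;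
  here \<open>r - x\<close> is \<open>sym_diff x r\<close> because every element is its own inverse.
\<close>

lemma totally_bounded_parity: "totally_bounded_group finite_set_group parity_topology"
  unfolding totally_bounded_group_def
proof (intro allI impI, elim conjE)
  fix V :: "'a set set"
  assume V: "openin parity_topology V" "V \<noteq> {}"
  then obtain x where x: "x \<in> V" by blast
  then have fx: "finite x" using openin_subset[OF V(1)] by auto
  obtain S where S: "finite S" "\<And>Y. finite Y \<Longrightarrow> (\<And>A. A \<in> S \<Longrightarrow> parity A Y = parity A x) \<Longrightarrow> Y \<in> V"
    using parity_topology_neighbourhood[OF V(1) x] by blast
  let ?sig = "\<lambda>X. {A \<in> S. parity A X}"
  have "finite (?sig ` Collect finite)"
    by (rule finite_subset[of _ "Pow S"]) (use S(1) in auto)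
  from finite_subset_image[OF this subset_refl]
  obtain R where R: "R \<subseteq> Collect finite" "finite R" "?sig ` Collect finite = ?sig ` R"
    by blast
  let ?F = "sym_diff x ` R"
  have "Collect finite \<subseteq> ?F <#>\<^bsub>finite_set_group\<^esub> V"
  proof
    fix Y :: "'a set" assume "Y \<in> Collect finite"
    then have fY: "finite Y" by simp
    then have "?sig Y \<in> ?sig ` R" using R(3) by blast
    then obtain r where r: "r \<in> R" "?sig Y = ?sig r" by blast
    then have fr: "finite r" using R by blast
    have "sym_diff x (sym_diff r Y) \<in> V"
      using r fx fr fY by (intro S(2)) (auto simp: parity_sym_diff)
    moreover have "Y = sym_diff (sym_diff x r) (sym_diff x (sym_diff r Y))" by blast
    ultimately show "Y \<in> ?F <#>\<^bsub>finite_set_group\<^esub> V"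
      using r unfolding set_mult_def finite_set_group_simps by blast
  qed
  moreover have F: "?F \<subseteq> Collect finite" using R(1) fx by auto
  moreover have "?F <#>\<^bsub>finite_set_group\<^esub> V \<subseteq> Collect finite"
  proof
    fix Y assume "Y \<in> ?F <#>\<^bsub>finite_set_group\<^esub> V"
    then obtain f v where "f \<in> ?F" "v \<in> V" "Y = sym_diff f v"
      unfolding set_mult_def finite_set_group_simps by blast
    moreover have "finite f" "finite v" using calculation F openin_subset[OF V(1)] by auto
    ultimately show "Y \<in> Collect finite" by simp
  qed
  ultimately have "carrier finite_set_group = ?F <#>\<^bsub>finite_set_group\<^esub> V"
    by (simp only: finite_set_group_simps subset_antisym)
  with F R(2) show "\<exists>F. finite F \<and> F \<subseteq> carrier finite_set_group \<and>
      carrier finite_set_group = F <#>\<^bsub>finite_set_group\<^esub> V"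
    by (metis finite_imageI finite_set_group_simps(1))
qed

text \<open>
  Each element of the group is a sum \<open>f + v\<close> with \<open>v \<in> V\<close> and \<open>f\<close> in a fixed finite set
  \<open>F\<close>, so a character vanishing on \<open>V\<close> is determined by its values on \<open>F\<close>.
\<close>

lemma finite_parities_trivial_on_open:
  fixes V :: "'a set set"
  assumes V: "openin parity_topology V" "V \<noteq> {}"
  shows "finite {A. \<forall>X\<in>V. \<not> parity A X}"
proof -
  have "\<exists>F. finite F \<and> F \<subseteq> Collect finite \<and> Collect finite = F <#>\<^bsub>finite_set_group\<^esub> V"
    using totally_bounded_parity V unfolding totally_bounded_group_def finite_set_group_simps
    by blast
  then obtain F where F: "finite F" "F \<subseteq> Collect finite"
    and cover: "Collect finite = F <#>\<^bsub>finite_set_group\<^esub> V"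
    by (elim exE conjE)
  let ?E = "{A. \<forall>X\<in>V. \<not> parity A X}"
  have "inj_on (\<lambda>A. {X \<in> F. parity A X}) ?E"
  proof (rule inj_onI)
    fix A B assume A: "A \<in> ?E" and B: "B \<in> ?E" and eq: "{X \<in> F. parity A X} = {X \<in> F. parity B X}"
    have "n \<in> A \<longleftrightarrow> n \<in> B" for n
    proof -
      have "{n} \<in> F <#>\<^bsub>finite_set_group\<^esub> V" unfolding cover[symmetric] by simp
      then obtain f v where fv: "f \<in> F" "v \<in> V" "{n} = sym_diff f v"
        unfolding set_mult_def finite_set_group_simps by blast
      have "finite f" using F(2) fv(1) by blast
      moreover have "finite v" using openin_subset[OF V(1)] fv(2) by auto
      ultimately have *: "parity C {n} \<longleftrightarrow> parity C f \<noteq> parity C v" for C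
        unfolding fv(3) by (rule parity_sym_diff)
      have "parity A f = parity B f" using eq fv(1) by blast
      then show ?thesis using *[of A] *[of B] A B fv(2) by simp
    qed
    then show "A = B" by blast
  qed
  moreover have "finite ((\<lambda>A. {X \<in> F. parity A X}) ` ?E)"
    by (rule finite_subset[of _ "Pow F"]) (use F(1) in auto)
  ultimately show ?thesis by (rule finite_imageD[rotated])
qed

lemma not_first_countable_parity_topology:
  assumes "infinite (UNIV :: 'a set)"
  shows "\<not> first_countable (parity_topology :: 'a set topology)"
proof
  assume "first_countable (parity_topology :: 'a set topology)"
  moreover have "{} \<in> topspace (parity_topology :: 'a set topology)" by simp
  ultimately obtain \<B> :: "'a set set set" where "countable \<B>"
    and op: "\<And>V. V \<in> \<B> \<Longrightarrow> openin parity_topology V"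
    and base: "\<And>U. openin parity_topology U \<Longrightarrow> {} \<in> U \<Longrightarrow> \<exists>V\<in>\<B>. {} \<in> V \<and> V \<subseteq> U"
    unfolding first_countable_def by meson
  \<comment> \<open>The kernel of each parity character is open, so it contains a member of the base. The empty
    set, on which all characters vanish, has to be left out of the union.\<close>
  have "UNIV \<subseteq> (\<Union>V\<in>\<B> - {{}}. {A. \<forall>X\<in>V. \<not> parity A X})"
  proof
    fix A :: "'a set"
    have "openin parity_topology {X \<in> topspace parity_topology. parity A X \<in> {False}}"
      by (rule openin_continuous_map_preimage[OF continuous_map_parity]) simp
    from base[OF this] obtain V where "V \<in> \<B>" "{} \<in> V" "\<forall>X\<in>V. \<not> parity A X" by auto
    then show "A \<in> (\<Union>V\<in>\<B> - {{}}. {A. \<forall>X\<in>V. \<not> parity A X})" by blast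
  qed
  moreover have "countable (\<Union>V\<in>\<B> - {{}}. {A. \<forall>X\<in>V. \<not> parity A X})"
  proof (rule countable_UN)
    show "countable (\<B> - {{}})" using \<open>countable \<B>\<close> by simp
    show "countable {A. \<forall>X\<in>V. \<not> parity A X}" if "V \<in> \<B> - {{}}" for V
      using that op by (intro countable_finite finite_parities_trivial_on_open) auto
  qed
  ultimately have "countable (UNIV :: 'a set set)" by (rule countable_subset)
  then obtain g :: "nat \<Rightarrow> 'a set" where g: "range g = UNIV"
    by (metis uncountable_def UNIV_not_empty)
  obtain h :: "nat \<Rightarrow> 'a" where h: "inj h" using assms infinite_countable_subset by blast
  have "surj (g \<circ> inv_into UNIV h)"
    using inj_imp_surj_inv[OF h] g by (rule comp_surj)
  then have "(g \<circ> inv_into UNIV h) ` UNIV = Pow UNIV" by simp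
  then show False using Cantors_theorem by blast
qed

section \<open>Groups whose subgroups are closed are determined\<close>

text \<open>A subgroup is the intersection of the kernels of the parity characters that vanish on it.\<close>

lemma closedin_subgroup_parity_topology:
  assumes D: "subgroup D finite_set_group"
  shows "closedin parity_topology D"
proof -
  let ?\<E> = "{A. \<forall>X\<in>D. \<not> parity A X}"
  let ?K = "\<lambda>A. {X \<in> topspace parity_topology. parity A X \<in> {False}}"
  have eq: "(\<Inter>A\<in>?\<E>. ?K A) = D"
  proof
    show "D \<subseteq> (\<Inter>A\<in>?\<E>. ?K A)" using subgroup_finite_set_groupD(2)[OF D] by auto
    show "(\<Inter>A\<in>?\<E>. ?K A) \<subseteq> D"
    proof
      fix x assume x: "x \<in> (\<Inter>A\<in>?\<E>. ?K A)"
      have "{} \<in> ?\<E>" by (simp add: parity_def)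
      then have "finite x" using x by auto
      with x show "x \<in> D" using parity_separates_subgroup[OF D, of x] by auto
    qed
  qed
  have "closedin parity_topology (?K A)" for A
    by (rule closedin_continuous_map_preimage[OF continuous_map_parity]) simp
  moreover have "?\<E> \<noteq> {}" by (auto simp: parity_def intro!: exI[of _ "{}"])
  ultimately have "closedin parity_topology (\<Inter>A\<in>?\<E>. ?K A)" by blast
  then show ?thesis unfolding eq .
qed

text \<open>
  The only dense subgroup is \<open>G\<close> itself, and restriction to \<open>carrier G\<close> is the identity on the
  dual, whose elements are extensional on \<open>carrier G\<close>.
\<close>

lemma determined_if_subgroups_closed:
  fixes G :: "'a monoid"
  assumes "topspace T = carrier G"
    and closed: "\<And>D. subgroup D G \<Longrightarrow> closedin T D"
  shows "determined G T"
  unfolding determined_def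
proof (intro allI impI)
  fix D assume "dense_subgroup D G T"
  then have "D = carrier G"
    using assms by (auto simp: dense_subgroup_def closure_of_closedin)
  moreover have "homeomorphic_map (compact_open_topology G T) (compact_open_topology G T)
      (\<lambda>h. restrict h (carrier G))"
    by (rule homeomorphic_map_eq[where f = id])
      (auto simp: topspace_compact_open_topology dual_group_def extensional_restrict)
  ultimately show "determines D G T"
    using assms(1) unfolding determines_def
    by (metis subtopology_topspace partial_object.surjective partial_object.update_convs(1))
qed

theorem theorem3p1:
  shows "\<exists>(G :: nat set monoid) (T :: nat set topology).
           topological_abelian_group G T \<and> Hausdorff_space T \<and>
           totally_bounded_group G T \<and> \<not> metrizable_space T \<and> determined G T"
proof (intro exI conjI)
  show "topological_abelian_group (finite_set_group :: nat set monoid) parity_topology"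
    by (rule topological_abelian_group_parity)
  show "Hausdorff_space (parity_topology :: nat set topology)"
    by (rule Hausdorff_space_parity_topology)
  show "totally_bounded_group (finite_set_group :: nat set monoid) parity_topology"
    by (rule totally_bounded_parity)
  show "\<not> metrizable_space (parity_topology :: nat set topology)"
    using not_first_countable_parity_topology metrizable_imp_first_countable by blast
  show "determined (finite_set_group :: nat set monoid) parity_topology"
    by (rule determined_if_subgroups_closed) (simp_all add: closedin_subgroup_parity_topology)
qed

end
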